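(* Let $I$ be an arbitrary (possibly infinite) index set and let $M=\prod_{i\in I}M_i$, where the $M_i$ are nontrivial monoids with zero satisfying $\mathrm{CCE}(M_i)=\{0,1\}$ for every $i\in I$. Then $M$ has the strict refinement property.
   Context: A monoid with zero is a monoid with an absorbing element $0$ ($0x=x0=0$ for all $x$); it is nontrivial if it has more than one element. For a monoid $M$, $\mathrm{CE}(M)=\{e\in M: e^2=e,\ ex=xe\ \text{for all }x\in M\}$ is the set of central idempotents, partially ordered by $e\le f\iff ef=e$. If $M$ has a zero, $e\in\mathrm{CE}(M)$ is complemented if there is $f\in\mathrm{CE}(M)$ such that $ef=0$ and $1$ is the unique common upper bound of $e$ and $f$ in $\mathrm{CE}(M)$; $\mathrm{CCE}(M)$ denotes the set of complemented central idempotents. A family of monoid homomorphisms $(f_j:M\to A_j)_{j\in J}$ ($J$ an arbitrary index set) is a product decomposition of $M$ if the induced map $M\to\prod_{j\in J}A_j$ is an isomorphism of monoids. A monoid $M$ has the strict refinement property if, for every pair of product decompositions $(f_j:M\to A_j)_{j\in J}$ and $(g_k:M\to B_k)_{k\in K}$, there exist monoids $C_{jk}$ and homomorphisms $\alpha_{jk}:A_j\to C_{jk}$, $\beta_{jk}:B_k\to C_{jk}$ such that $\alpha_{jk}f_j=\beta_{jk}g_k$ for every $(j,k)\in J\times K$, and such that the induced maps $A_j\to\prod_{k\in K}C_{jk}$ and $B_k\to\prod_{j\in J}C_{jk}$ are isomorphisms for every $j\in J$ and $k\in K$. *)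

theory Defs
  imports "HOL-Algebra.Product_Groups"
begin

section \<open>Monoids with zero and central idempotents\<close>

definition is_zero :: "('a, 'x) monoid_scheme \<Rightarrow> 'a \<Rightarrow> bool" where
  "is_zero M z \<longleftrightarrow> z \<in> carrier M \<and> (\<forall>x\<in>carrier M. z \<otimes>\<^bsub>M\<^esub> x = z \<and> x \<otimes>\<^bsub>M\<^esub> z = z)"

definition monoid_with_zero :: "('a, 'x) monoid_scheme \<Rightarrow> bool" where
  "monoid_with_zero M \<longleftrightarrow> monoid M \<and> (\<exists>z. is_zero M z)"

text \<open>An absorbing element is unique if it exists, so the description below is meaningful
  for every monoid with zero.\<close>

definition zero_of :: "('a, 'x) monoid_scheme \<Rightarrow> 'a" where
  "zero_of M = (THE z. is_zero M z)"

lemma zero_of_eqI: "is_zero M z \<Longrightarrow> zero_of M = z"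
  unfolding zero_of_def by (rule the_equality) (auto simp: is_zero_def)

lemma is_zero_zero_of: "monoid_with_zero M \<Longrightarrow> is_zero M (zero_of M)"
  unfolding monoid_with_zero_def by (metis zero_of_eqI)

definition nontrivial :: "('a, 'x) monoid_scheme \<Rightarrow> bool" where
  "nontrivial M \<longleftrightarrow> (\<exists>x\<in>carrier M. \<exists>y\<in>carrier M. x \<noteq> y)"

definition CE :: "('a, 'x) monoid_scheme \<Rightarrow> 'a set" where
  "CE M = {e \<in> carrier M. e \<otimes>\<^bsub>M\<^esub> e = e \<and> (\<forall>x\<in>carrier M. e \<otimes>\<^bsub>M\<^esub> x = x \<otimes>\<^bsub>M\<^esub> e)}"

definition CE_le :: "('a, 'x) monoid_scheme \<Rightarrow> 'a \<Rightarrow> 'a \<Rightarrow> bool" where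
  "CE_le M e f \<longleftrightarrow> e \<otimes>\<^bsub>M\<^esub> f = e"

definition CCE :: "('a, 'x) monoid_scheme \<Rightarrow> 'a set" where
  "CCE M = {e \<in> CE M. \<exists>f\<in>CE M. e \<otimes>\<^bsub>M\<^esub> f = zero_of M \<and>
                       {u \<in> CE M. CE_le M e u \<and> CE_le M f u} = {\<one>\<^bsub>M\<^esub>}}"

section \<open>Product decompositions and strict refinement\<close>

text \<open>\<open>hom\<close> does not require preservation of the unit.\<close>

definition monoid_hom :: "('a, 'x) monoid_scheme \<Rightarrow> ('b, 'y) monoid_scheme \<Rightarrow> ('a \<Rightarrow> 'b) set" where
  "monoid_hom M N = {h \<in> hom M N. h \<one>\<^bsub>M\<^esub> = \<one>\<^bsub>N\<^esub>}"

text \<open>Despite its name, \<open>product_group\<close> is the direct product of an arbitrary family of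
  monoids, with componentwise operations.\<close>

definition product_decomposition ::
  "('m, 'x) monoid_scheme \<Rightarrow> 'j set \<Rightarrow> ('j \<Rightarrow> ('a, 'y) monoid_scheme) \<Rightarrow> ('j \<Rightarrow> 'm \<Rightarrow> 'a) \<Rightarrow> bool" where
  "product_decomposition M J A f \<longleftrightarrow>
     monoid M \<and> (\<forall>j\<in>J. monoid (A j) \<and> f j \<in> monoid_hom M (A j)) \<and>
     (\<lambda>x. \<lambda>j\<in>J. f j x) \<in> iso M (product_group J A)"

text \<open>The type arguments are the types of the indices and of the elements of the factors in
  the two given decompositions. HOL cannot quantify over them inside the definition, so the
  unrestricted property is the statement for all instances of \<open>'j\<close>, \<open>'k\<close>, \<open>'a\<close>, \<open>'b\<close>.
  The monoids \<open>C j k\<close> may be taken over the type of elements of \<open>M\<close> without loss of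
  generality: the induced maps being isomorphisms, \<open>\<alpha> j k \<circ> f j\<close> maps \<open>M\<close> onto \<open>C j k\<close>,
  so the structure of \<open>C j k\<close> can be transported to a set of representatives in \<open>M\<close>.\<close>

definition strict_refinement_property ::
  "'j itself \<Rightarrow> 'k itself \<Rightarrow> 'a itself \<Rightarrow> 'b itself \<Rightarrow> 'm monoid \<Rightarrow> bool" where
  "strict_refinement_property (_ :: 'j itself) (_ :: 'k itself) (_ :: 'a itself) (_ :: 'b itself) M \<longleftrightarrow>
     (\<forall>(J :: 'j set) (A :: 'j \<Rightarrow> 'a monoid) f (K :: 'k set) (B :: 'k \<Rightarrow> 'b monoid) g.
        product_decomposition M J A f \<and> product_decomposition M K B g \<longrightarrow>
        (\<exists>(C :: 'j \<Rightarrow> 'k \<Rightarrow> 'm monoid) \<alpha> \<beta>.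
           (\<forall>j\<in>J. \<forall>k\<in>K.
              monoid (C j k) \<and>
              \<alpha> j k \<in> monoid_hom (A j) (C j k) \<and>
              \<beta> j k \<in> monoid_hom (B k) (C j k) \<and>
              (\<forall>x\<in>carrier M. \<alpha> j k (f j x) = \<beta> j k (g k x))) \<and>
           (\<forall>j\<in>J. product_decomposition (A j) K (C j) (\<alpha> j)) \<and>
           (\<forall>k\<in>K. product_decomposition (B k) J (\<lambda>j. C j k) (\<lambda>j. \<beta> j k))))"

end

(* A decomposition M = \<Prod>_j A_j turns the unit of A_j into a complemented central idempotent e_j of M.
   Its coordinates are complemented central idempotents of the M_i, hence 0 or 1, so e_j is the
   indicator of a set S_j, and f_j x = f_j y iff x and y agree on S_j. The sets S_j partition I,
   and two decompositions with partitions S and T have the common refinement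
   C_jk = \<Prod>_{i \<in> S_j \<inter> T_k} M_i. *)

theory Submission
  imports Defs "HOL-Library.Disjoint_Sets"
begin

section \<open>Direct products and the components of a product decomposition\<close>

lemma monoid_product_group:
  assumes "\<And>i. i \<in> I \<Longrightarrow> monoid (M i)"
  shows "monoid (product_group I M)"
proof (rule monoidI)
  fix x assume x: "x \<in> carrier (product_group I M)"
  then show "\<one>\<^bsub>product_group I M\<^esub> \<otimes>\<^bsub>product_group I M\<^esub> x = x"
    "x \<otimes>\<^bsub>product_group I M\<^esub> \<one>\<^bsub>product_group I M\<^esub> = x"
    using assms
    by (auto simp: PiE_iff fun_eq_iff extensional_def)
qed (use assms in \<open>auto simp: PiE_iff fun_eq_iff monoid.m_closed monoid.one_closed monoid.m_assoc\<close>)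

lemma is_zero_product_group:
  assumes "\<And>i. i \<in> I \<Longrightarrow> is_zero (M i) (z i)"
  shows "is_zero (product_group I M) (\<lambda>i\<in>I. z i)"
  using assms by (auto simp: is_zero_def PiE_iff fun_eq_iff extensional_def)

lemma product_decomposition_eqI:
  assumes "product_decomposition M J A f" "x \<in> carrier M" "y \<in> carrier M"
    and "\<And>j. j \<in> J \<Longrightarrow> f j x = f j y"
  shows "x = y"
proof -
  have "inj_on (\<lambda>x. \<lambda>j\<in>J. f j x) (carrier M)"
    using assms(1) by (auto simp: product_decomposition_def iso_def bij_betw_def)
  moreover have "(\<lambda>j\<in>J. f j x) = (\<lambda>j\<in>J. f j y)"
    using assms(4) by auto
  ultimately show ?thesis
    using assms(2,3) by (auto dest: inj_onD)
qed

lemma product_decomposition_surj: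
  assumes "product_decomposition M J A f" and "\<And>j. j \<in> J \<Longrightarrow> a j \<in> carrier (A j)"
  obtains x where "x \<in> carrier M" "\<And>j. j \<in> J \<Longrightarrow> f j x = a j"
proof -
  have "(\<lambda>j\<in>J. a j) \<in> (\<lambda>x. \<lambda>j\<in>J. f j x) ` carrier M"
    using assms by (auto simp: product_decomposition_def iso_def bij_betw_def)
  then obtain x where x: "x \<in> carrier M" "(\<lambda>j\<in>J. a j) = (\<lambda>j\<in>J. f j x)"
    by blast
  show ?thesis
    using that[of x] x by (metis restrict_apply')
qed

text \<open>Units in the other factors complete an element of \<open>A j\<close> to a full family,
  which the isomorphism lifts to \<open>M\<close>. Surjectivity later allows maps out of
  \<open>A j\<close> to be defined through preimages in \<open>M\<close>.\<close>

lemma product_decomposition_component_surj: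
  assumes dec: "product_decomposition M J A f" and j: "j \<in> J"
  shows "f j ` carrier M = carrier (A j)"
proof
  show "f j ` carrier M \<subseteq> carrier (A j)"
    using dec j by (auto simp: product_decomposition_def monoid_hom_def hom_def)
  show "carrier (A j) \<subseteq> f j ` carrier M"
  proof
    fix a assume a: "a \<in> carrier (A j)"
    have "(if k = j then a else \<one>\<^bsub>A k\<^esub>) \<in> carrier (A k)" if "k \<in> J" for k
      using dec that a by (auto simp: product_decomposition_def monoid.one_closed)
    then obtain x where "x \<in> carrier M" "\<And>k. k \<in> J \<Longrightarrow> f k x = (if k = j then a else \<one>\<^bsub>A k\<^esub>)"
      using product_decomposition_surj[OF dec, of "\<lambda>k. if k = j then a else \<one>\<^bsub>A k\<^esub>"] by blast
    then show "a \<in> f j ` carrier M"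
      using j by force
  qed
qed

section \<open>Complemented central idempotents\<close>

text \<open>The idempotent is the preimage of the family with the unit at \<open>j\<close> and the
  images of zero elsewhere. Multiplying by it keeps the component at \<open>j\<close> and collapses
  all others, so it detects equality under \<open>f j\<close> exactly.\<close>

lemma product_decomposition_idempotent:
  assumes dec: "product_decomposition M J A f" and z: "is_zero M z" and j: "j \<in> J"
  obtains e where "e \<in> CCE M"
    and "\<And>x y. x \<in> carrier M \<Longrightarrow> y \<in> carrier M \<Longrightarrow> f j x = f j y \<longleftrightarrow> e \<otimes>\<^bsub>M\<^esub> x = e \<otimes>\<^bsub>M\<^esub> y"
    and "\<And>k. k \<in> J \<Longrightarrow> k \<noteq> j \<Longrightarrow> f k e = f k z"
proof -
  interpret M: monoid M
    using dec by (simp add: product_decomposition_def)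
  have mon: "monoid (A k)" and one: "f k \<one>\<^bsub>M\<^esub> = \<one>\<^bsub>A k\<^esub>"
    and cl: "\<And>x. x \<in> carrier M \<Longrightarrow> f k x \<in> carrier (A k)"
    and mult: "\<And>x y. x \<in> carrier M \<Longrightarrow> y \<in> carrier M \<Longrightarrow> f k (x \<otimes>\<^bsub>M\<^esub> y) = f k x \<otimes>\<^bsub>A k\<^esub> f k y"
    if "k \<in> J" for k
    using dec that by (auto simp: product_decomposition_def monoid_hom_def hom_def)
  have zc [simp]: "z \<in> carrier M"
    using z by (simp add: is_zero_def)
  have fz: "f k z \<otimes>\<^bsub>A k\<^esub> f k x = f k z" "f k x \<otimes>\<^bsub>A k\<^esub> f k z = f k z"
    if "k \<in> J" "x \<in> carrier M" for k x
    using z that mult by (metis is_zero_def zc)+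
  note l_one = monoid.l_one[OF mon cl] and r_one = monoid.r_one[OF mon cl]
  obtain e where e [simp]: "e \<in> carrier M"
    and fe: "\<And>k. k \<in> J \<Longrightarrow> f k e = (if k = j then \<one>\<^bsub>A k\<^esub> else f k z)"
    using product_decomposition_surj[OF dec, of "\<lambda>k. if k = j then \<one>\<^bsub>A k\<^esub> else f k z"]
    by (metis cl mon monoid.one_closed zc)
  \<comment> \<open>The complement has unit and zero exchanged, so in each factor one of
    \<open>e\<close>, \<open>e'\<close> maps to the unit and the other to the image of zero.\<close>
  obtain e' where e' [simp]: "e' \<in> carrier M"
    and fe': "\<And>k. k \<in> J \<Longrightarrow> f k e' = (if k = j then f k z else \<one>\<^bsub>A k\<^esub>)"
    using product_decomposition_surj[OF dec, of "\<lambda>k. if k = j then f k z else \<one>\<^bsub>A k\<^esub>"]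
    by (metis cl mon monoid.one_closed zc)
  note eqI = product_decomposition_eqI[OF dec]
  note simps = mult fe fe' fz l_one r_one one monoid.l_one[OF mon monoid.one_closed[OF mon]]
  \<comment> \<open>All components of \<open>e\<close> and \<open>e'\<close> are units or images of
    zero, which are idempotent and commute with every \<open>f k x\<close>. Joint injectivity of the
    \<open>f k\<close> lifts these equations to \<open>M\<close>.\<close>
  have "g \<otimes>\<^bsub>M\<^esub> g = g" "\<And>x. x \<in> carrier M \<Longrightarrow> g \<otimes>\<^bsub>M\<^esub> x = x \<otimes>\<^bsub>M\<^esub> g" if "g = e \<or> g = e'" for g
    by (rule eqI; use that in \<open>force simp: simps\<close>)+
  then have CE: "e \<in> CE M" "e' \<in> CE M"
    by (simp_all add: CE_def)
  have "e \<otimes>\<^bsub>M\<^esub> e' = z"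
    by (rule eqI) (auto simp: simps)
  then have zero: "e \<otimes>\<^bsub>M\<^esub> e' = zero_of M"
    using zero_of_eqI[OF z] by simp
  \<comment> \<open>In the factor \<open>j\<close> the bound on \<open>e\<close> forces the
    component of \<open>u\<close> to be the unit; in the other factors the bound on
    \<open>e'\<close> does.\<close>
  have "u = \<one>\<^bsub>M\<^esub>" if u: "u \<in> carrier M" "e \<otimes>\<^bsub>M\<^esub> u = e" "e' \<otimes>\<^bsub>M\<^esub> u = e'" for u
  proof (rule eqI)
    fix k assume k: "k \<in> J"
    have "f k e \<otimes>\<^bsub>A k\<^esub> f k u = f k e" "f k e' \<otimes>\<^bsub>A k\<^esub> f k u = f k e'"
      using u mult[OF k] e e' by metis+
    then show "f k u = f k \<one>\<^bsub>M\<^esub>"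
      using k u(1) by (cases "k = j") (auto simp: fe fe' l_one one)
  qed (use u in auto)
  then have "{u \<in> CE M. CE_le M e u \<and> CE_le M e' u} = {\<one>\<^bsub>M\<^esub>}"
    by (auto simp: CE_def CE_le_def)
  then have "e \<in> CCE M"
    using CE zero unfolding CCE_def by blast
  moreover have "f j x = f j y \<longleftrightarrow> e \<otimes>\<^bsub>M\<^esub> x = e \<otimes>\<^bsub>M\<^esub> y"
    if xy: "x \<in> carrier M" "y \<in> carrier M" for x y
  proof
    assume "f j x = f j y"
    then show "e \<otimes>\<^bsub>M\<^esub> x = e \<otimes>\<^bsub>M\<^esub> y"
      using xy by (intro eqI) (auto simp: mult fe fz l_one)
  next
    assume "e \<otimes>\<^bsub>M\<^esub> x = e \<otimes>\<^bsub>M\<^esub> y"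
    then have "f j e \<otimes>\<^bsub>A j\<^esub> f j x = f j e \<otimes>\<^bsub>A j\<^esub> f j y"
      using xy j mult e by metis
    then show "f j x = f j y"
      using xy j by (simp add: fe l_one)
  qed
  ultimately show thesis
    using that[of e] j fe by auto
qed

text \<open>If \<open>f\<close> is a complement of \<open>e\<close>, then \<open>f i\<close> is one
  of \<open>e i\<close>. An upper bound of \<open>e i\<close> and \<open>f i\<close>, padded by
  units, is an upper bound of \<open>e\<close> and \<open>f\<close>, hence the unit.\<close>

lemma CCE_product_group_component:
  assumes zero: "\<And>i. i \<in> I \<Longrightarrow> monoid_with_zero (M i)"
    and e: "e \<in> CCE (product_group I M)" and i: "i \<in> I"
  shows "e i \<in> CCE (M i)"
proof -
  let ?P = "product_group I M"
  have mon: "monoid (M k)" if "k \<in> I" for k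
    using zero[OF that] by (simp add: monoid_with_zero_def)
  have z: "is_zero ?P (\<lambda>k\<in>I. zero_of (M k))"
    by (intro is_zero_product_group is_zero_zero_of zero)
  obtain f where f: "f \<in> CE ?P" and ef: "e \<otimes>\<^bsub>?P\<^esub> f = zero_of ?P"
    and ub: "{u \<in> CE ?P. CE_le ?P e u \<and> CE_le ?P f u} = {\<one>\<^bsub>?P\<^esub>}"
    using e by (auto simp: CCE_def)
  \<comment> \<open>Padded elements serve twice: they test centrality in the coordinate
    \<open>i\<close>, and they lift upper bounds from \<open>M i\<close>, because the unit lies
    above every central idempotent in the other coordinates.\<close>
  define ext where "ext x = (\<lambda>k\<in>I. if k = i then x else \<one>\<^bsub>M k\<^esub>)" for x
  have ext: "ext x \<in> carrier ?P" if "x \<in> carrier (M i)" for x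
    using that mon by (auto simp: ext_def monoid.one_closed)
  have comp: "g i \<in> CE (M i)" if g: "g \<in> CE ?P" for g
  proof -
    have "g i \<otimes>\<^bsub>M i\<^esub> x = x \<otimes>\<^bsub>M i\<^esub> g i" if x: "x \<in> carrier (M i)" for x
    proof -
      have "(g \<otimes>\<^bsub>?P\<^esub> ext x) i = (ext x \<otimes>\<^bsub>?P\<^esub> g) i"
        using g ext[OF x] by (simp only: CE_def mem_Collect_eq)
      then show ?thesis
        using i by (simp add: ext_def)
    qed
    moreover have "(g \<otimes>\<^bsub>?P\<^esub> g) i = g i"
      using g by (simp only: CE_def mem_Collect_eq)
    ultimately show ?thesis
      using g i by (auto simp: CE_def)
  qed
  have eC: "e \<in> CE ?P"
    using e by (simp add: CCE_def)
  have "(e \<otimes>\<^bsub>?P\<^esub> f) i = zero_of (M i)"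
    using ef zero_of_eqI[OF z] i by simp
  then have ef_i: "e i \<otimes>\<^bsub>M i\<^esub> f i = zero_of (M i)"
    using i by simp
  have "u = \<one>\<^bsub>M i\<^esub>"
    if u: "u \<in> CE (M i)" and eu: "e i \<otimes>\<^bsub>M i\<^esub> u = e i" and fu: "f i \<otimes>\<^bsub>M i\<^esub> u = f i" for u
  proof -
    have uc: "u \<in> carrier (M i)"
      using u by (simp add: CE_def)
    have "ext u \<in> CE ?P"
      using u ext[OF uc] mon
      by (auto simp: CE_def ext_def PiE_iff fun_eq_iff)
    moreover have "CE_le ?P g (ext u)" if "g \<in> CE ?P" "g i \<otimes>\<^bsub>M i\<^esub> u = g i" for g
      using that mon
      by (auto simp: CE_le_def CE_def ext_def PiE_iff fun_eq_iff extensional_def)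
    ultimately have "ext u = \<one>\<^bsub>?P\<^esub>"
      using ub eC f eu fu by blast
    then have "ext u i = \<one>\<^bsub>?P\<^esub> i"
      by simp
    then show ?thesis
      using i by (simp add: ext_def)
  qed
  moreover have "\<one>\<^bsub>M i\<^esub> \<in> CE (M i)"
    using mon[OF i] by (auto simp: CE_def)
  moreover have e1: "e i \<otimes>\<^bsub>M i\<^esub> \<one>\<^bsub>M i\<^esub> = e i" and f1: "f i \<otimes>\<^bsub>M i\<^esub> \<one>\<^bsub>M i\<^esub> = f i"
    using comp[OF eC] comp[OF f] mon[OF i] by (simp_all add: CE_def)
  ultimately have "{u \<in> CE (M i). CE_le (M i) (e i) u \<and> CE_le (M i) (f i) u} = {\<one>\<^bsub>M i\<^esub>}"
    using e1 f1 unfolding CE_le_def by blast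
  then show ?thesis
    using comp[OF eC] comp[OF f] ef_i unfolding CCE_def by blast
qed

text \<open>If zero were the unit, then \<open>x = 1 x = 0 x = 0\<close> for every
  \<open>x\<close>.\<close>

lemma zero_of_neq_one:
  assumes "monoid_with_zero M" "nontrivial M"
  shows "zero_of M \<noteq> \<one>\<^bsub>M\<^esub>"
  using assms is_zero_zero_of[OF assms(1)]
  by (metis is_zero_def monoid.l_one monoid_with_zero_def nontrivial_def)

section \<open>The partition of the index set given by a decomposition\<close>

text \<open>The block \<open>S j\<close> is the support of the idempotent belonging to
  \<open>f j\<close>, whose coordinates are all zero or unit. A block may be empty; this happens
  when \<open>A j\<close> is trivial.\<close>

lemma product_decomposition_partition:
  assumes zero: "\<And>i. i \<in> I \<Longrightarrow> monoid_with_zero (M i)"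
    and nontriv: "\<And>i. i \<in> I \<Longrightarrow> nontrivial (M i)"
    and indec: "\<And>i. i \<in> I \<Longrightarrow> CCE (M i) = {zero_of (M i), \<one>\<^bsub>M i\<^esub>}"
    and dec: "product_decomposition (product_group I M) J A f"
  obtains S where "(\<Union>j\<in>J. S j) = I" "disjoint_family_on S J"
    and "\<And>j x y. j \<in> J \<Longrightarrow> x \<in> carrier (product_group I M) \<Longrightarrow> y \<in> carrier (product_group I M) \<Longrightarrow>
      f j x = f j y \<longleftrightarrow> (\<forall>i\<in>S j. x i = y i)"
proof -
  let ?P = "product_group I M"
  have mon: "monoid (M i)" and z: "is_zero (M i) (zero_of (M i))"
    and zo: "zero_of (M i) \<noteq> \<one>\<^bsub>M i\<^esub>" if "i \<in> I" for i
    using zero[OF that] is_zero_zero_of[OF zero[OF that]] zero_of_neq_one[OF zero nontriv, OF that that]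
    by (auto simp: monoid_with_zero_def)
  define z where "z = (\<lambda>i\<in>I. zero_of (M i))"
  have isz: "is_zero ?P z"
    unfolding z_def by (intro is_zero_product_group z)
  have "\<exists>e. \<forall>j\<in>J. e j \<in> CCE ?P \<and>
      (\<forall>x\<in>carrier ?P. \<forall>y\<in>carrier ?P. f j x = f j y \<longleftrightarrow> e j \<otimes>\<^bsub>?P\<^esub> x = e j \<otimes>\<^bsub>?P\<^esub> y) \<and>
      (\<forall>k\<in>J. k \<noteq> j \<longrightarrow> f k (e j) = f k z)"
    by (intro bchoice ballI) (rule product_decomposition_idempotent[OF dec isz], assumption, blast)
  then obtain e where eC: "\<And>j. j \<in> J \<Longrightarrow> e j \<in> CCE ?P"
    and ef: "\<And>j x y. j \<in> J \<Longrightarrow> x \<in> carrier ?P \<Longrightarrow> y \<in> carrier ?P \<Longrightarrow>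
        f j x = f j y \<longleftrightarrow> e j \<otimes>\<^bsub>?P\<^esub> x = e j \<otimes>\<^bsub>?P\<^esub> y"
    and ez: "\<And>j k. j \<in> J \<Longrightarrow> k \<in> J \<Longrightarrow> k \<noteq> j \<Longrightarrow> f k (e j) = f k z"
    by blast
  define S where "S j = {i \<in> I. e j i = \<one>\<^bsub>M i\<^esub>}" for j
  have e_off: "e j i = zero_of (M i)" if "j \<in> J" "i \<in> I" "i \<notin> S j" for i j
    using CCE_product_group_component[OF zero eC] indec that by (auto simp: S_def)
  have ec: "e j \<in> carrier ?P" if "j \<in> J" for j
    using eC[OF that] by (simp add: CCE_def CE_def)
  have zc: "z \<in> carrier ?P"
    using isz by (simp add: is_zero_def)
  have agree: "f j x = f j y \<longleftrightarrow> (\<forall>i\<in>S j. x i = y i)"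
    if j: "j \<in> J" and xy: "x \<in> carrier ?P" "y \<in> carrier ?P" for j x y
  proof -
    \<comment> \<open>On \<open>S j\<close> the coordinate of \<open>e j\<close> is the unit and
      preserves \<open>x i\<close> and \<open>y i\<close>; off \<open>S j\<close> it is zero and
      erases both.\<close>
    have eq: "e j i \<otimes>\<^bsub>M i\<^esub> x i = e j i \<otimes>\<^bsub>M i\<^esub> y i \<longleftrightarrow> (i \<in> S j \<longrightarrow> x i = y i)" if i: "i \<in> I" for i
    proof -
      have "x i \<in> carrier (M i)" "y i \<in> carrier (M i)"
        using xy i by auto
      then show ?thesis
        using e_off[OF j i] z[OF i] mon[OF i]
        by (cases "i \<in> S j") (auto simp: S_def is_zero_def monoid.l_one)
    qed
    have "f j x = f j y \<longleftrightarrow> (\<forall>i\<in>I. e j i \<otimes>\<^bsub>M i\<^esub> x i = e j i \<otimes>\<^bsub>M i\<^esub> y i)"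
      using ef[OF j xy] by (auto simp: fun_eq_iff)
    also have "\<dots> \<longleftrightarrow> (\<forall>i\<in>S j. x i = y i)"
      using eq by (auto simp: S_def)
    finally show ?thesis .
  qed
  have "disjoint_family_on S J"
  proof (unfold disjoint_family_on_def, intro ballI impI)
    fix j k assume jk: "j \<in> J" "k \<in> J" "j \<noteq> k"
    \<comment> \<open>\<open>f k\<close> does not distinguish \<open>e j\<close> from
      \<open>z\<close>, so they agree on \<open>S k\<close>. On \<open>S j\<close> the coordinates
      of \<open>e j\<close> are units, and unit and zero differ.\<close>
    have "\<forall>i\<in>S k. e j i = z i"
      using agree[OF jk(2) ec[OF jk(1)] zc] ez jk by simp
    then show "S j \<inter> S k = {}"
      using zo by (auto simp: S_def z_def)
  qed
  moreover have "(\<Union>j\<in>J. S j) = I"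
  proof (rule ccontr)
    assume "(\<Union>j\<in>J. S j) \<noteq> I"
    then obtain i where i: "i \<in> I" "\<And>j. j \<in> J \<Longrightarrow> i \<notin> S j"
      by (auto simp: S_def)
    \<comment> \<open>This element differs from the unit only at the uncovered index
      \<open>i\<close>, so no \<open>f j\<close> can separate the two, contrary to joint
      injectivity.\<close>
    define x where "x = (\<lambda>k\<in>I. if k = i then zero_of (M k) else \<one>\<^bsub>M k\<^esub>)"
    have xc: "x \<in> carrier ?P" and oc: "\<one>\<^bsub>?P\<^esub> \<in> carrier ?P"
      using mon z by (auto simp: x_def is_zero_def monoid.one_closed)
    have "f j x = f j \<one>\<^bsub>?P\<^esub>" if "j \<in> J" for j
      using agree[OF that xc oc] i(2)[OF that] by (auto simp: x_def S_def)
    then have "x i = \<one>\<^bsub>?P\<^esub> i"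
      using product_decomposition_eqI[OF dec xc oc] by simp
    then show False
      using i zo by (simp add: x_def)
  qed
  ultimately show thesis
    using that agree by blast
qed

section \<open>Splitting a factor along a partition of its block\<close>

text \<open>Since \<open>f\<close> identifies elements exactly when they agree on \<open>S\<close>,
  it is restriction to \<open>S\<close> up to isomorphism, and cutting \<open>S\<close> into the
  \<open>R k\<close> cuts \<open>A\<close> into the corresponding products. The formula for
  \<open>\<alpha>\<close> on values of \<open>f\<close> is a separate conclusion because it gives
  the compatibility of two refinements.\<close>

lemma product_decomposition_restrict:
  fixes I S :: "'i set" and M :: "'i \<Rightarrow> 'c monoid" and A :: "'a monoid" and R :: "'k \<Rightarrow> 'i set"
    and f :: "('i \<Rightarrow> 'c) \<Rightarrow> 'a"
  defines "\<alpha> \<equiv> \<lambda>k a. restrict (inv_into (carrier (product_group I M)) f a) (R k)"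
  assumes mon: "\<And>i. i \<in> I \<Longrightarrow> monoid (M i)" and A: "monoid A"
    and f: "f \<in> monoid_hom (product_group I M) A"
    and surj: "f ` carrier (product_group I M) = carrier A"
    and eq: "\<And>x y. x \<in> carrier (product_group I M) \<Longrightarrow> y \<in> carrier (product_group I M) \<Longrightarrow>
      f x = f y \<longleftrightarrow> (\<forall>i\<in>S. x i = y i)"
    and S: "S \<subseteq> I" "(\<Union>k\<in>K. R k) = S" "disjoint_family_on R K"
  shows "\<And>k x. k \<in> K \<Longrightarrow> x \<in> carrier (product_group I M) \<Longrightarrow> \<alpha> k (f x) = restrict x (R k)"
    and "product_decomposition A K (\<lambda>k. product_group (R k) M) \<alpha>"
proof -
  let ?P = "product_group I M"
  have RS: "R k \<subseteq> S" "R k \<subseteq> I" if "k \<in> K" for k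
    using S that by auto
  have one: "f \<one>\<^bsub>?P\<^esub> = \<one>\<^bsub>A\<^esub>" and mult: "\<And>x y. x \<in> carrier ?P \<Longrightarrow> y \<in> carrier ?P \<Longrightarrow>
      f (x \<otimes>\<^bsub>?P\<^esub> y) = f x \<otimes>\<^bsub>A\<^esub> f y"
    using f by (auto simp: monoid_hom_def hom_def)
  interpret P: monoid ?P
    by (intro monoid_product_group mon)
  show \<alpha>: "\<alpha> k (f x) = restrict x (R k)" if k: "k \<in> K" and x: "x \<in> carrier ?P" for k x
  proof -
    \<comment> \<open>The chosen preimage need not be \<open>x\<close>, but it has the same image,
      so it agrees with \<open>x\<close> on \<open>S\<close> and thus on \<open>R k\<close>.\<close>
    have "f (inv_into (carrier ?P) f (f x)) = f x"
      by (rule f_inv_into_f[OF imageI[OF x]])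
    then have "\<forall>i\<in>S. inv_into (carrier ?P) f (f x) i = x i"
      using eq x by (metis imageI inv_into_into)
    then show ?thesis
      using RS[OF k] by (auto simp: \<alpha>_def fun_eq_iff)
  qed
  \<comment> \<open>Every element of \<open>A\<close> has the form \<open>f x\<close>, and there
    \<open>\<alpha> k\<close> acts as restriction, which respects the componentwise
    operations.\<close>
  have hom: "\<alpha> k \<in> monoid_hom A (product_group (R k) M)" if k: "k \<in> K" for k
  proof -
    have "\<alpha> k a \<in> carrier (product_group (R k) M)" if a: "a \<in> carrier A" for a
    proof -
      obtain x where x: "x \<in> carrier ?P" "a = f x"
        using a surj by blast
      show ?thesis
        unfolding x(2) \<alpha>[OF k x(1)] using x(1) RS[OF k] by (auto simp: PiE_iff)
    qed
    moreover have "\<alpha> k (a \<otimes>\<^bsub>A\<^esub> b) = \<alpha> k a \<otimes>\<^bsub>product_group (R k) M\<^esub> \<alpha> k b"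
      if ab: "a \<in> carrier A" "b \<in> carrier A" for a b
    proof -
      obtain x y where xy: "x \<in> carrier ?P" "a = f x" "y \<in> carrier ?P" "b = f y"
        using ab surj by blast
      have "restrict (x \<otimes>\<^bsub>?P\<^esub> y) (R k) = restrict x (R k) \<otimes>\<^bsub>product_group (R k) M\<^esub> restrict y (R k)"
        using RS[OF k] by (auto simp: fun_eq_iff)
      then show ?thesis
        using \<alpha>[OF k] xy P.m_closed by (metis mult)
    qed
    moreover have "\<alpha> k \<one>\<^bsub>A\<^esub> = \<one>\<^bsub>product_group (R k) M\<^esub>"
      using \<alpha>[OF k P.one_closed, unfolded one] RS[OF k] by (auto simp: fun_eq_iff)
    ultimately show ?thesis
      by (simp add: monoid_hom_def hom_def)
  qed
  let ?h = "\<lambda>a. \<lambda>k\<in>K. \<alpha> k a"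
  have "?h \<in> hom A (product_group K (\<lambda>k. product_group (R k) M))"
    using hom by (auto simp: monoid_hom_def hom_def fun_eq_iff Pi_iff PiE_iff extensional_def)
  moreover have "inj_on ?h (carrier A)"
  proof (rule inj_onI)
    fix a b assume ab: "a \<in> carrier A" "b \<in> carrier A" and h: "?h a = ?h b"
    obtain x y where xy: "x \<in> carrier ?P" "a = f x" "y \<in> carrier ?P" "b = f y"
      using ab surj by blast
    have "restrict x (R k) = restrict y (R k)" if k: "k \<in> K" for k
      using fun_cong[OF h, of k] k \<alpha> xy by simp
    then have "\<forall>i\<in>S. x i = y i"
      unfolding S(2)[symmetric] by (metis UN_E restrict_apply')
    then show "a = b"
      using eq xy by simp
  qed
  moreover have "c \<in> ?h ` carrier A"
    if c: "c \<in> carrier (product_group K (\<lambda>k. product_group (R k) M))" for c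
  proof -
    \<comment> \<open>The family \<open>c\<close> is glued to one element: by disjointness each
      index in \<open>S\<close> lies in a single \<open>R k\<close>. Off \<open>S\<close> the value
      does not affect \<open>f x\<close>, and the unit is a default in the carrier.\<close>
    define x where "x = (\<lambda>i\<in>I. if i \<in> S then c (THE k. k \<in> K \<and> i \<in> R k) i else \<one>\<^bsub>M i\<^esub>)"
    have the: "(THE k. k \<in> K \<and> i \<in> R k) = k" if "k \<in> K" "i \<in> R k" for i k
      using that S(3) by (intro the_equality) (auto simp: disjoint_family_on_def)
    have xk: "x i = c k i" if "k \<in> K" "i \<in> R k" for i k
      using that RS[OF that(1)] by (auto simp: x_def the)
    have ck: "c k \<in> carrier (product_group (R k) M)" if "k \<in> K" for k
      using c that by auto
    have "x i \<in> carrier (M i)" if i: "i \<in> I" for i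
    proof (cases "i \<in> S")
      case True
      then obtain k where k: "k \<in> K" "i \<in> R k"
        using S(2) by blast
      then show ?thesis
        using ck[OF k(1)] xk[OF k] by auto
    next
      case False
      then show ?thesis
        using i mon by (simp add: x_def monoid.one_closed)
    qed
    then have x: "x \<in> carrier ?P"
      by (auto simp: x_def)
    have "restrict x (R k) = c k" if k: "k \<in> K" for k
      using ck[OF k] xk[OF k] by (auto simp: fun_eq_iff PiE_iff extensional_def)
    then have "c = ?h (f x)"
      using c \<alpha>[OF _ x] by (auto simp: fun_eq_iff PiE_iff extensional_def)
    then show ?thesis
      using x surj by blast
  qed
  ultimately have "?h \<in> iso A (product_group K (\<lambda>k. product_group (R k) M))"
    unfolding iso_def bij_betw_def by (blast dest: hom_in_carrier)
  moreover have "monoid (product_group (R k) M)" if "k \<in> K" for k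
    using RS[OF that] by (intro monoid_product_group mon) auto
  ultimately show "product_decomposition A K (\<lambda>k. product_group (R k) M) \<alpha>"
    using A hom by (simp add: product_decomposition_def)
qed

section \<open>The common refinement of two decompositions\<close>

theorem corollary3p10:
  fixes I :: "'i set" and M :: "'i \<Rightarrow> 'c monoid"
  assumes "\<And>i. i \<in> I \<Longrightarrow> monoid_with_zero (M i)"
    and "\<And>i. i \<in> I \<Longrightarrow> nontrivial (M i)"
    and "\<And>i. i \<in> I \<Longrightarrow> CCE (M i) = {zero_of (M i), \<one>\<^bsub>M i\<^esub>}"
  shows "strict_refinement_property TYPE('j) TYPE('k) TYPE('a) TYPE('b) (product_group I M)"
  unfolding strict_refinement_property_def
proof (intro allI impI, elim conjE)
  let ?P = "product_group I M"
  fix J :: "'j set" and A :: "'j \<Rightarrow> 'a monoid" and f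
  fix K :: "'k set" and B :: "'k \<Rightarrow> 'b monoid" and g
  assume f: "product_decomposition ?P J A f" and g: "product_decomposition ?P K B g"
  have mon: "\<And>i. i \<in> I \<Longrightarrow> monoid (M i)"
    using assms(1) by (simp add: monoid_with_zero_def)
  obtain S where S: "(\<Union>j\<in>J. S j) = I" "disjoint_family_on S J"
    and Sf: "\<And>j x y. j \<in> J \<Longrightarrow> x \<in> carrier ?P \<Longrightarrow> y \<in> carrier ?P \<Longrightarrow>
      f j x = f j y \<longleftrightarrow> (\<forall>i\<in>S j. x i = y i)"
    using product_decomposition_partition[OF assms f] by blast
  obtain T where T: "(\<Union>k\<in>K. T k) = I" "disjoint_family_on T K"
    and Tg: "\<And>k x y. k \<in> K \<Longrightarrow> x \<in> carrier ?P \<Longrightarrow> y \<in> carrier ?P \<Longrightarrow>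
      g k x = g k y \<longleftrightarrow> (\<forall>i\<in>T k. x i = y i)"
    using product_decomposition_partition[OF assms g] by blast
  have fA: "monoid (A j)" "f j \<in> monoid_hom ?P (A j)" if "j \<in> J" for j
    using f that by (auto simp: product_decomposition_def)
  have gB: "monoid (B k)" "g k \<in> monoid_hom ?P (B k)" if "k \<in> K" for k
    using g that by (auto simp: product_decomposition_def)
  have fsurj: "f j ` carrier ?P = carrier (A j)" if "j \<in> J" for j
    by (rule product_decomposition_component_surj[OF f that])
  have gsurj: "g k ` carrier ?P = carrier (B k)" if "k \<in> K" for k
    by (rule product_decomposition_component_surj[OF g that])
  \<comment> \<open>Both maps into \<open>C j k\<close> pick a preimage in the product and restrict
    it to the same intersection. Empty intersections give trivial monoids.\<close>
  define C where "C j k = product_group (S j \<inter> T k) M" for j k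
  define \<alpha> where "\<alpha> j k = (\<lambda>a. restrict (inv_into (carrier ?P) (f j) a) (S j \<inter> T k))" for j k
  define \<beta> where "\<beta> j k = (\<lambda>b. restrict (inv_into (carrier ?P) (g k) b) (S j \<inter> T k))" for j k
  \<comment> \<open>The second partition cuts each block of the first into disjoint pieces, and
    conversely.\<close>
  have SJ: "S j \<subseteq> I" "(\<Union>k\<in>K. S j \<inter> T k) = S j" "disjoint_family_on (\<lambda>k. S j \<inter> T k) K" if "j \<in> J" for j
    using S(1) T that unfolding disjoint_family_on_def by blast+
  have TK: "T k \<subseteq> I" "(\<Union>j\<in>J. S j \<inter> T k) = T k" "disjoint_family_on (\<lambda>j. S j \<inter> T k) J" if "k \<in> K" for k
    using S T(1) that unfolding disjoint_family_on_def by blast+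
  have \<alpha>: "product_decomposition (A j) K (C j) (\<alpha> j)"
    and \<alpha>f: "\<And>k x. k \<in> K \<Longrightarrow> x \<in> carrier ?P \<Longrightarrow> \<alpha> j k (f j x) = restrict x (S j \<inter> T k)"
    if j: "j \<in> J" for j
    using product_decomposition_restrict[OF mon fA(1)[OF j] fA(2)[OF j] fsurj[OF j] Sf[OF j] SJ[OF j]]
    by (auto simp: \<alpha>_def[abs_def] C_def[abs_def])
  have \<beta>: "product_decomposition (B k) J (\<lambda>j. C j k) (\<lambda>j. \<beta> j k)"
    and \<beta>g: "\<And>j x. j \<in> J \<Longrightarrow> x \<in> carrier ?P \<Longrightarrow> \<beta> j k (g k x) = restrict x (S j \<inter> T k)"
    if k: "k \<in> K" for k
    using product_decomposition_restrict[OF mon gB(1)[OF k] gB(2)[OF k] gsurj[OF k] Tg[OF k] TK[OF k]]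
    by (auto simp: \<beta>_def[abs_def] C_def[abs_def])
  \<comment> \<open>Compatibility holds because both composites send \<open>x\<close> to its
    restriction to \<open>S j \<inter> T k\<close>.\<close>
  have "\<forall>j\<in>J. \<forall>k\<in>K. monoid (C j k) \<and> \<alpha> j k \<in> monoid_hom (A j) (C j k) \<and>
      \<beta> j k \<in> monoid_hom (B k) (C j k) \<and> (\<forall>x\<in>carrier ?P. \<alpha> j k (f j x) = \<beta> j k (g k x))"
    using \<alpha> \<beta> by (simp add: product_decomposition_def \<alpha>f \<beta>g)
  then show "\<exists>(C :: 'j \<Rightarrow> 'k \<Rightarrow> ('i \<Rightarrow> 'c) monoid) \<alpha> \<beta>.
      (\<forall>j\<in>J. \<forall>k\<in>K. monoid (C j k) \<and> \<alpha> j k \<in> monoid_hom (A j) (C j k) \<and>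
        \<beta> j k \<in> monoid_hom (B k) (C j k) \<and> (\<forall>x\<in>carrier ?P. \<alpha> j k (f j x) = \<beta> j k (g k x))) \<and>
      (\<forall>j\<in>J. product_decomposition (A j) K (C j) (\<alpha> j)) \<and>
      (\<forall>k\<in>K. product_decomposition (B k) J (\<lambda>j. C j k) (\<lambda>j. \<beta> j k))"
    using \<alpha> \<beta> by (intro exI[of _ C] exI[of _ \<alpha>] exI[of _ \<beta>]) blast
qed

end
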